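(* Let $\mathbb{C}$ be a regular unital category with binary coproducts, comonadic covers $(P,\delta,\varepsilon)$ and a natural imaginary splitting $t$. Let $f\colon X\to Y$ with section $s\colon Y\to X$ and $g\colon Y\to Z$ with section $v\colon Z\to Y$ be split epimorphisms in $\mathbb{C}$. If $(gf,sv)$ is an intrinsic Schreier split extension, then so is $(g,v)$.
   Context: Setting. A pointed finitely complete category is unital when for all objects $A,B$ the pair $\langle 1_A,0\rangle\colon A\to A\times B$, $\langle 0,1_B\rangle\colon B\to A\times B$ is jointly extremal-epimorphic. "Comonadic covers" means a comonad $(P,\delta,\varepsilon)$ on $\mathbb{C}$ such that every $\varepsilon_X\colon P(X)\to X$ is a regular epimorphism. A natural imaginary splitting is a natural transformation with components $t_{A,B}\colon P(A\times B)\to A+B$ such that $r_{A,B}t_{A,B}=\varepsilon_{A\times B}$, where $r_{A,B}\colon A+B\to A\times B$ is the canonical comparison morphism (with $\pi_A r_{A,B}=(1_A\;0)$ and $\pi_B r_{A,B}=(0\;1_B)$). Imaginary morphisms. An imaginary morphism $a\colon X\dashrightarrow Y$ is a morphism $a\colon P(X)\to Y$ in $\mathbb{C}$, i.e. a morphism of the Kleisli category of $P$; composition of $a\colon A\dashrightarrow B$ and $b\colon B\dashrightarrow C$ is $b\circ a=b\,P(a)\,\delta_A$. A real morphism $f\colon X\to Y$ of $\mathbb{C}$ is viewed as $\overline{f}=f\varepsilon_X\colon X\dashrightarrow Y$; for real $v$, $u$ one writes $v\circ a=va\;(=\overline{v}\circ a)$ and $a\circ u=aP(u)\;(=a\circ\overline{u})$.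 Finite products of $\mathbb{C}$ are also products for imaginary morphisms: $\langle a,b\rangle$ is the usual pairing in $\mathbb{C}$. Imaginary addition: $\mu^X\colon X\times X\dashrightarrow X$ is $\mu^X=(1_X\;1_X)\,t_{X,X}\colon P(X\times X)\to X+X\to X$. Intrinsic Schreier split epimorphism (also called, together with its kernel, intrinsic Schreier split extension): a split epimorphism $f\colon X\to Y$ with chosen section $s$ and kernel $k\colon K\to X$ for which there is an imaginary morphism $q\colon X\dashrightarrow K$ with $\mu^X\circ\langle k\circ q,\overline{sf}\rangle=\overline{1_X}$ and $q\circ\mu^X\circ(k\times s)=\overline{\pi_K}$, where $\pi_K\colon K\times Y\to K$ is the projection. *)

theory Defs
  imports Main
begin

section \<open>Categories\<close>

text \<open>Objects and arrows are relativised to the carriers \<open>Obj\<close> and \<open>Arr\<close>. Composition is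
  written in the usual order, \<open>g \<cdot> f\<close> meaning \<open>g\<close> after \<open>f\<close>, and is constrained only on
  composable pairs.\<close>

record ('o, 'a) category =
  Obj :: "'o set"
  Arr :: "'a set"
  Dom :: "'a \<Rightarrow> 'o"
  Cod :: "'a \<Rightarrow> 'o"
  Ide :: "'o \<Rightarrow> 'a"
  Comp :: "'a \<Rightarrow> 'a \<Rightarrow> 'a" (infixr "\<cdot>\<index>" 70)

definition Hom :: "('o, 'a, 'm) category_scheme \<Rightarrow> 'o \<Rightarrow> 'o \<Rightarrow> 'a set" where
  "Hom C A B = {f \<in> Arr C. Dom C f = A \<and> Cod C f = B}"

locale category =
  fixes C (structure)
  assumes Dom_Obj: "f \<in> Arr C \<Longrightarrow> Dom C f \<in> Obj C"
    and Cod_Obj: "f \<in> Arr C \<Longrightarrow> Cod C f \<in> Obj C"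
    and Ide_Hom: "A \<in> Obj C \<Longrightarrow> Ide C A \<in> Hom C A A"
    and Comp_Hom: "f \<in> Hom C A B \<Longrightarrow> g \<in> Hom C B D \<Longrightarrow> g \<cdot> f \<in> Hom C A D"
    and Comp_Ide: "f \<in> Hom C A B \<Longrightarrow> f \<cdot> Ide C A = f"
    and Ide_Comp: "f \<in> Hom C A B \<Longrightarrow> Ide C B \<cdot> f = f"
    and Comp_assoc: "f \<in> Hom C A B \<Longrightarrow> g \<in> Hom C B D \<Longrightarrow> h \<in> Hom C D E \<Longrightarrow>
      (h \<cdot> g) \<cdot> f = h \<cdot> (g \<cdot> f)"

definition is_mono where
  "is_mono C m \<longleftrightarrow> m \<in> Arr C \<and>
    (\<forall>W. \<forall>u \<in> Hom C W (Dom C m). \<forall>v \<in> Hom C W (Dom C m). m \<cdot> u = m \<cdot> v \<longrightarrow> u = v)"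
  for C (structure)

definition is_iso where
  "is_iso C m \<longleftrightarrow> m \<in> Arr C \<and>
    (\<exists>n \<in> Hom C (Cod C m) (Dom C m). n \<cdot> m = Ide C (Dom C m) \<and> m \<cdot> n = Ide C (Cod C m))"
  for C (structure)

section \<open>Finite limits\<close>

text \<open>A finite diagram consists of vertices \<open>D 0, \<dots>, D (n - 1)\<close> and a finite set \<open>E\<close> of
  labelled edges, \<open>(i, j, u)\<close> standing for an arrow \<open>u\<close> from \<open>D i\<close> to \<open>D j\<close>.\<close>

definition finite_diagram ::
  "('o, 'a, 'm) category_scheme \<Rightarrow> nat \<Rightarrow> (nat \<Rightarrow> 'o) \<Rightarrow> (nat \<times> nat \<times> 'a) set \<Rightarrow> bool" where
  "finite_diagram C n D E \<longleftrightarrow> (\<forall>i<n. D i \<in> Obj C) \<and> finite E \<and>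
    (\<forall>(i, j, u) \<in> E. i < n \<and> j < n \<and> u \<in> Hom C (D i) (D j))"

definition is_cone where
  "is_cone C n D E L c \<longleftrightarrow> L \<in> Obj C \<and> (\<forall>i<(n::nat). c i \<in> Hom C L (D i)) \<and>
    (\<forall>(i, j, u) \<in> E. u \<cdot> c i = c j)"
  for C (structure)

definition is_limit where
  "is_limit C n D E L c \<longleftrightarrow> is_cone C n D E L c \<and>
    (\<forall>L' c'. is_cone C n D E L' c' \<longrightarrow> (\<exists>!h. h \<in> Hom C L' L \<and> (\<forall>i<n. c i \<cdot> h = c' i)))"
  for C (structure)

definition finitely_complete where
  "finitely_complete C \<longleftrightarrow>
    (\<forall>n D E. finite_diagram C n D E \<longrightarrow> (\<exists>L c. is_limit C n D E L c))"

definition is_product where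
  "is_product C A B Q p q \<longleftrightarrow> p \<in> Hom C Q A \<and> q \<in> Hom C Q B \<and>
    (\<forall>W. \<forall>u \<in> Hom C W A. \<forall>v \<in> Hom C W B. \<exists>!h. h \<in> Hom C W Q \<and> p \<cdot> h = u \<and> q \<cdot> h = v)"
  for C (structure)

definition is_coproduct where
  "is_coproduct C A B S i j \<longleftrightarrow> i \<in> Hom C A S \<and> j \<in> Hom C B S \<and>
    (\<forall>W. \<forall>u \<in> Hom C A W. \<forall>v \<in> Hom C B W. \<exists>!h. h \<in> Hom C S W \<and> h \<cdot> i = u \<and> h \<cdot> j = v)"
  for C (structure)

definition is_pullback where
  "is_pullback C f g R p q \<longleftrightarrow> f \<in> Arr C \<and> g \<in> Arr C \<and> Cod C f = Cod C g \<and>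
    p \<in> Hom C R (Dom C f) \<and> q \<in> Hom C R (Dom C g) \<and> f \<cdot> p = g \<cdot> q \<and>
    (\<forall>W. \<forall>u \<in> Hom C W (Dom C f). \<forall>v \<in> Hom C W (Dom C g). f \<cdot> u = g \<cdot> v \<longrightarrow>
      (\<exists>!h. h \<in> Hom C W R \<and> p \<cdot> h = u \<and> q \<cdot> h = v))"
  for C (structure)

section \<open>Regular categories\<close>

definition is_coequalizer where
  "is_coequalizer C u v e \<longleftrightarrow> u \<in> Arr C \<and> v \<in> Hom C (Dom C u) (Cod C u) \<and>
    e \<in> Arr C \<and> Dom C e = Cod C u \<and> e \<cdot> u = e \<cdot> v \<and>
    (\<forall>W. \<forall>w \<in> Hom C (Cod C u) W. w \<cdot> u = w \<cdot> v \<longrightarrow>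
      (\<exists>!h. h \<in> Hom C (Cod C e) W \<and> h \<cdot> e = w))"
  for C (structure)

definition is_regular_epi where
  "is_regular_epi C e \<longleftrightarrow> (\<exists>u v. is_coequalizer C u v e)"

locale regular_category = category C for C (structure) +
  assumes finitely_complete: "finitely_complete C"
    and kernel_pair_coequalizer:
      "is_pullback C f f R p q \<Longrightarrow> \<exists>e. is_coequalizer C p q e"
    and regular_epi_stable:
      "is_pullback C f g R p q \<Longrightarrow> is_regular_epi C f \<Longrightarrow> is_regular_epi C q"

section \<open>Pointed and unital categories\<close>

definition is_zero_object where
  "is_zero_object C Z \<longleftrightarrow> Z \<in> Obj C \<and>
    (\<forall>A \<in> Obj C. (\<exists>!h. h \<in> Hom C A Z) \<and> (\<exists>!h. h \<in> Hom C Z A))"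

definition Zero :: "('o, 'a, 'm) category_scheme \<Rightarrow> 'o \<Rightarrow> 'o \<Rightarrow> 'a" where
  "Zero C A B = (THE h. \<exists>Z a b. is_zero_object C Z \<and> a \<in> Hom C A Z \<and> b \<in> Hom C Z B \<and> h = b \<cdot> a)"
  for C (structure)

definition is_kernel where
  "is_kernel C f K k \<longleftrightarrow> f \<in> Arr C \<and> k \<in> Hom C K (Dom C f) \<and> f \<cdot> k = Zero C K (Cod C f) \<and>
    (\<forall>W. \<forall>u \<in> Hom C W (Dom C f). f \<cdot> u = Zero C W (Cod C f) \<longrightarrow>
      (\<exists>!h. h \<in> Hom C W K \<and> k \<cdot> h = u))"
  for C (structure)

definition jointly_extremal_epi where
  "jointly_extremal_epi C l r \<longleftrightarrow> l \<in> Arr C \<and> r \<in> Arr C \<and> Cod C l = Cod C r \<and>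
    (\<forall>m l' r'. is_mono C m \<and> Cod C m = Cod C l \<and>
      l' \<in> Hom C (Dom C l) (Dom C m) \<and> r' \<in> Hom C (Dom C r) (Dom C m) \<and>
      m \<cdot> l' = l \<and> m \<cdot> r' = r \<longrightarrow> is_iso C m)"
  for C (structure)

locale unital_category = category C for C (structure) +
  assumes finitely_complete: "finitely_complete C"
    and pointed: "\<exists>Z. is_zero_object C Z"
    and unital: "is_product C A B Q p q \<Longrightarrow>
      l \<in> Hom C A Q \<Longrightarrow> p \<cdot> l = Ide C A \<Longrightarrow> q \<cdot> l = Zero C A B \<Longrightarrow>
      r \<in> Hom C B Q \<Longrightarrow> p \<cdot> r = Zero C B A \<Longrightarrow> q \<cdot> r = Ide C B \<Longrightarrow>
      jointly_extremal_epi C l r"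

section \<open>Chosen binary products and coproducts\<close>

record ('o, 'a) binary_data = "('o, 'a) category" +
  Prd :: "'o \<Rightarrow> 'o \<Rightarrow> 'o"
  Pr1 :: "'o \<Rightarrow> 'o \<Rightarrow> 'a"
  Pr2 :: "'o \<Rightarrow> 'o \<Rightarrow> 'a"
  Cop :: "'o \<Rightarrow> 'o \<Rightarrow> 'o"
  In1 :: "'o \<Rightarrow> 'o \<Rightarrow> 'a"
  In2 :: "'o \<Rightarrow> 'o \<Rightarrow> 'a"

locale binary_products = category C for C (structure) +
  assumes product: "A \<in> Obj C \<Longrightarrow> B \<in> Obj C \<Longrightarrow>
    is_product C A B (Prd C A B) (Pr1 C A B) (Pr2 C A B)"

locale binary_coproducts = category C for C (structure) +
  assumes coproduct: "A \<in> Obj C \<Longrightarrow> B \<in> Obj C \<Longrightarrow>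
    is_coproduct C A B (Cop C A B) (In1 C A B) (In2 C A B)"

definition Pairing where
  "Pairing C f g = (THE h. h \<in> Hom C (Dom C f) (Prd C (Cod C f) (Cod C g)) \<and>
    Pr1 C (Cod C f) (Cod C g) \<cdot> h = f \<and> Pr2 C (Cod C f) (Cod C g) \<cdot> h = g)"
  for C (structure)

definition Copairing where
  "Copairing C f g = (THE h. h \<in> Hom C (Cop C (Dom C f) (Dom C g)) (Cod C f) \<and>
    h \<cdot> In1 C (Dom C f) (Dom C g) = f \<and> h \<cdot> In2 C (Dom C f) (Dom C g) = g)"
  for C (structure)

definition PrdMap where
  "PrdMap C f g = Pairing C (f \<cdot> Pr1 C (Dom C f) (Dom C g)) (g \<cdot> Pr2 C (Dom C f) (Dom C g))"
  for C (structure)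

definition CopMap where
  "CopMap C f g = Copairing C (In1 C (Cod C f) (Cod C g) \<cdot> f) (In2 C (Cod C f) (Cod C g) \<cdot> g)"
  for C (structure)

text \<open>The canonical morphism from \<open>A + B\<close> to \<open>A \<times> B\<close>, whose projections are \<open>(1  0)\<close> and \<open>(0  1)\<close>.\<close>

definition Comparison where
  "Comparison C A B =
    Pairing C (Copairing C (Ide C A) (Zero C B A)) (Copairing C (Zero C A B) (Ide C B))"

section \<open>Comonadic covers and imaginary morphisms\<close>

record ('o, 'a) imaginary_data = "('o, 'a) binary_data" +
  PObj :: "'o \<Rightarrow> 'o"
  PArr :: "'a \<Rightarrow> 'a"
  Delta :: "'o \<Rightarrow> 'a"
  Eps :: "'o \<Rightarrow> 'a"
  Split :: "'o \<Rightarrow> 'o \<Rightarrow> 'a"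

locale comonad = category C for C (structure) +
  assumes PArr_Hom: "f \<in> Hom C A B \<Longrightarrow> PArr C f \<in> Hom C (PObj C A) (PObj C B)"
    and PObj_Obj: "A \<in> Obj C \<Longrightarrow> PObj C A \<in> Obj C"
    and PArr_Ide: "A \<in> Obj C \<Longrightarrow> PArr C (Ide C A) = Ide C (PObj C A)"
    and PArr_Comp: "f \<in> Hom C A B \<Longrightarrow> g \<in> Hom C B D \<Longrightarrow>
      PArr C (g \<cdot> f) = PArr C g \<cdot> PArr C f"
    and Delta_Hom: "A \<in> Obj C \<Longrightarrow> Delta C A \<in> Hom C (PObj C A) (PObj C (PObj C A))"
    and Delta_natural: "f \<in> Hom C A B \<Longrightarrow>
      Delta C B \<cdot> PArr C f = PArr C (PArr C f) \<cdot> Delta C A"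
    and Eps_Hom: "A \<in> Obj C \<Longrightarrow> Eps C A \<in> Hom C (PObj C A) A"
    and Eps_natural: "f \<in> Hom C A B \<Longrightarrow> Eps C B \<cdot> PArr C f = f \<cdot> Eps C A"
    and Eps_Delta: "A \<in> Obj C \<Longrightarrow> Eps C (PObj C A) \<cdot> Delta C A = Ide C (PObj C A)"
    and PArr_Eps_Delta: "A \<in> Obj C \<Longrightarrow> PArr C (Eps C A) \<cdot> Delta C A = Ide C (PObj C A)"
    and Delta_Delta: "A \<in> Obj C \<Longrightarrow>
      Delta C (PObj C A) \<cdot> Delta C A = PArr C (Delta C A) \<cdot> Delta C A"

locale comonadic_covers = comonad C for C (structure) +
  assumes cover: "A \<in> Obj C \<Longrightarrow> is_regular_epi C (Eps C A)"

definition natural_imaginary_splitting where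
  "natural_imaginary_splitting C \<longleftrightarrow>
    (\<forall>A \<in> Obj C. \<forall>B \<in> Obj C.
      Split C A B \<in> Hom C (PObj C (Prd C A B)) (Cop C A B) \<and>
      Comparison C A B \<cdot> Split C A B = Eps C (Prd C A B)) \<and>
    (\<forall>f \<in> Arr C. \<forall>g \<in> Arr C.
      Split C (Cod C f) (Cod C g) \<cdot> PArr C (PrdMap C f g) =
        CopMap C f g \<cdot> Split C (Dom C f) (Dom C g))"
  for C (structure)

text \<open>An imaginary morphism from \<open>A\<close> to \<open>B\<close> is an element of \<open>Hom C (PObj C A) B\<close>. As \<open>PObj C\<close>
  need not be injective, \<open>A\<close> is not determined by the arrow, and the Kleisli composite
  \<open>ImComp C A b a\<close> of \<open>b\<close> after \<open>a\<close> carries it explicitly.\<close>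

definition ImComp where
  "ImComp C A b a = b \<cdot> PArr C a \<cdot> Delta C A"
  for C (structure)

definition Real where
  "Real C f = f \<cdot> Eps C (Dom C f)"
  for C (structure)

definition ImAdd where
  "ImAdd C X = Copairing C (Ide C X) (Ide C X) \<cdot> Split C X X"
  for C (structure)

section \<open>Intrinsic Schreier split extensions\<close>

definition split_epi where
  "split_epi C X Y f s \<longleftrightarrow> f \<in> Hom C X Y \<and> s \<in> Hom C Y X \<and> f \<cdot> s = Ide C Y"
  for C (structure)

text \<open>With \<open>\<mu>\<close> the imaginary addition of \<open>X\<close>, and with real morphisms read as imaginary ones, the
  two equations on \<open>q\<close> are \<open>\<mu> \<circ> \<langle>k \<circ> q, s f\<rangle> = 1\<close> and
  \<open>q \<circ> \<mu> \<circ> (k \<times> s) = \<pi>\<close>, the compositions being those of the Kleisli category. For the real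
  morphism \<open>k\<close>, the Kleisli composite \<open>k \<circ> q\<close> is \<open>k \<cdot> q\<close>.\<close>

definition intrinsic_schreier where
  "intrinsic_schreier C X Y f s K k \<longleftrightarrow> split_epi C X Y f s \<and> is_kernel C f K k \<and>
    (\<exists>q \<in> Hom C (PObj C X) K.
      ImComp C X (ImAdd C X) (Pairing C (k \<cdot> q) (Real C (s \<cdot> f))) = Real C (Ide C X) \<and>
      ImComp C (Prd C K Y) (ImComp C (Prd C X X) q (ImAdd C X)) (Real C (PrdMap C k s)) =
        Real C (Pr1 C K Y))"
  for C (structure)

end

theory Submission
  imports Defs
begin

text \<open>The split extension \<open>(g, v)\<close> is a retract of \<open>(gf, sv)\<close> in the category of split
  extensions: \<open>f\<close> and \<open>s\<close> are maps of split epimorphisms over the identity of \<open>Z\<close>, they restrict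
  to maps \<open>f'\<close> and \<open>s'\<close> between the kernels, and \<open>f s = 1\<close>, \<open>f' s' = 1\<close>. Schreier structures pass
  to retracts: given an imaginary retraction \<open>q\<close> of the large split extension, one goes up along
  \<open>s\<close>, applies \<open>q\<close>, and comes down along \<open>f'\<close>, that is, one takes \<open>f' q P(s)\<close>.

  Both Schreier equations for \<open>f' q P(s)\<close> then follow from the naturality of the imaginary
  addition, \<open>\<mu> \<circ> (f \<times> f) = f \<circ> \<mu>\<close>, which comes from that of the imaginary splitting and of the
  codiagonal. In the first equation \<open>f\<close> is pulled out of \<open>\<mu>\<close> on the left and \<open>P(s)\<close> on the right,
  leaving \<open>f s = 1\<close> around the equation for \<open>q\<close>. In the second one \<open>s\<close> is pushed through \<open>\<mu>\<close>
  onto the arguments, where it turns a pair from \<open>L\<close> and \<open>Z\<close> into a pair from \<open>K\<close> and \<open>Z\<close>; the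
  equation for \<open>q\<close> extracts the first component, and \<open>f' s' = 1\<close> remains.\<close>

section \<open>Typing of composites\<close>

context category
begin

lemma Hom_iff: "f \<in> Hom C A B \<longleftrightarrow> f \<in> Arr C \<and> Dom C f = A \<and> Cod C f = B"
  by (auto simp: Hom_def)

lemma Hom_Obj:
  assumes "f \<in> Hom C A B"
  shows "A \<in> Obj C" "B \<in> Obj C"
  using assms Dom_Obj Cod_Obj by (auto simp: Hom_def)

text \<open>With the domains and codomains read off the arrows, the simplifier can type-check
  composites and bring them to right-associated form by itself.\<close>

lemma comp_arrow:
  assumes "f \<in> Arr C" "g \<in> Arr C" "Cod C f = Dom C g"
  shows "g \<cdot> f \<in> Arr C" "Dom C (g \<cdot> f) = Dom C f" "Cod C (g \<cdot> f) = Cod C g"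
  using assms Comp_Hom[of f "Dom C f" "Cod C f" g "Cod C g"] by (auto simp: Hom_iff)

lemma comp_assoc:
  assumes "f \<in> Arr C" "g \<in> Arr C" "h \<in> Arr C" "Cod C f = Dom C g" "Cod C g = Dom C h"
  shows "(h \<cdot> g) \<cdot> f = h \<cdot> g \<cdot> f"
  using assms Comp_assoc[of f "Dom C f" "Cod C f" g "Cod C g" h "Cod C h"] by (auto simp: Hom_iff)

lemma ide_arrow:
  assumes "A \<in> Obj C"
  shows "Ide C A \<in> Arr C" "Dom C (Ide C A) = A" "Cod C (Ide C A) = A"
  using assms Ide_Hom by (auto simp: Hom_iff)

lemma comp_ide:
  assumes "f \<in> Arr C"
  shows "Dom C f = A \<Longrightarrow> f \<cdot> Ide C A = f" "Cod C f = B \<Longrightarrow> Ide C B \<cdot> f = f"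
  using assms Comp_Ide Ide_Comp by (auto simp: Hom_iff)

lemmas arrow_simps = Hom_iff comp_arrow comp_assoc ide_arrow comp_ide Dom_Obj Cod_Obj

end

section \<open>Binary products and coproducts\<close>

context binary_products
begin

lemma Pr_Hom:
  assumes "A \<in> Obj C" "B \<in> Obj C"
  shows "Pr1 C A B \<in> Hom C (Prd C A B) A" "Pr2 C A B \<in> Hom C (Prd C A B) B"
  using product[OF assms] by (auto simp: is_product_def)

lemma product_universal:
  assumes "u \<in> Hom C W A" "w \<in> Hom C W B"
  shows "\<exists>!h. h \<in> Hom C W (Prd C A B) \<and> Pr1 C A B \<cdot> h = u \<and> Pr2 C A B \<cdot> h = w"
  using product[OF Hom_Obj(2)[OF assms(1)] Hom_Obj(2)[OF assms(2)]] assms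
  by (simp add: is_product_def)

lemma Pairing_props:
  assumes "u \<in> Hom C W A" "w \<in> Hom C W B"
  shows "Pairing C u w \<in> Hom C W (Prd C A B)"
    and "Pr1 C A B \<cdot> Pairing C u w = u"
    and "Pr2 C A B \<cdot> Pairing C u w = w"
proof -
  have "Pairing C u w =
      (THE h. h \<in> Hom C W (Prd C A B) \<and> Pr1 C A B \<cdot> h = u \<and> Pr2 C A B \<cdot> h = w)"
    using assms by (simp add: Pairing_def Hom_iff)
  with theI'[OF product_universal[OF assms]] show "Pairing C u w \<in> Hom C W (Prd C A B)"
    and "Pr1 C A B \<cdot> Pairing C u w = u" and "Pr2 C A B \<cdot> Pairing C u w = w"
    by simp_all
qed

lemma Pairing_unique:
  assumes "A \<in> Obj C" "B \<in> Obj C" "h \<in> Hom C W (Prd C A B)"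
    and "Pr1 C A B \<cdot> h = u" "Pr2 C A B \<cdot> h = w"
  shows "Pairing C u w = h"
proof -
  have u: "u \<in> Hom C W A" "w \<in> Hom C W B"
    using Comp_Hom[OF assms(3) Pr_Hom(1)[OF assms(1,2)]] Comp_Hom[OF assms(3) Pr_Hom(2)[OF assms(1,2)]]
    by (simp_all only: assms(4,5))
  from ex1_iff_ex_Uniq[THEN iffD1, OF product_universal[OF this], THEN conjunct2] show ?thesis
    by (rule Uniq_D) (intro conjI Pairing_props[OF u] assms(3-5))+
qed

lemma PrdMap_props:
  assumes f: "f \<in> Hom C A A'" and g: "g \<in> Hom C B B'"
  shows "PrdMap C f g \<in> Hom C (Prd C A B) (Prd C A' B')"
    and "Pr1 C A' B' \<cdot> PrdMap C f g = f \<cdot> Pr1 C A B"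
    and "Pr2 C A' B' \<cdot> PrdMap C f g = g \<cdot> Pr2 C A B"
proof -
  have d: "PrdMap C f g = Pairing C (f \<cdot> Pr1 C A B) (g \<cdot> Pr2 C A B)"
    using f g by (simp add: PrdMap_def Hom_iff)
  note r = Pr_Hom[OF Hom_Obj(1)[OF f] Hom_Obj(1)[OF g]]
  from Pairing_props[OF Comp_Hom[OF r(1) f] Comp_Hom[OF r(2) g]]
  show "PrdMap C f g \<in> Hom C (Prd C A B) (Prd C A' B')"
    and "Pr1 C A' B' \<cdot> PrdMap C f g = f \<cdot> Pr1 C A B"
    and "Pr2 C A' B' \<cdot> PrdMap C f g = g \<cdot> Pr2 C A B"
    by (simp_all add: d)
qed

lemma Pairing_comp:
  assumes u: "u \<in> Hom C W A" "w \<in> Hom C W B" and p: "p \<in> Hom C V W"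
  shows "Pairing C u w \<cdot> p = Pairing C (u \<cdot> p) (w \<cdot> p)"
proof (rule Pairing_unique[symmetric])
  note P = Pairing_props[OF u]
  show o: "A \<in> Obj C" "B \<in> Obj C"
    using u Hom_Obj by blast+
  show "Pairing C u w \<cdot> p \<in> Hom C V (Prd C A B)"
    by (rule Comp_Hom[OF p P(1)])
  show "Pr1 C A B \<cdot> Pairing C u w \<cdot> p = u \<cdot> p"
    using Comp_assoc[OF p P(1) Pr_Hom(1)[OF o]] P(2) by simp
  show "Pr2 C A B \<cdot> Pairing C u w \<cdot> p = w \<cdot> p"
    using Comp_assoc[OF p P(1) Pr_Hom(2)[OF o]] P(3) by simp
qed

lemma PrdMap_Pairing:
  assumes f: "f \<in> Hom C A A'" and g: "g \<in> Hom C B B'"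
    and u: "u \<in> Hom C W A" and w: "w \<in> Hom C W B"
  shows "PrdMap C f g \<cdot> Pairing C u w = Pairing C (f \<cdot> u) (g \<cdot> w)"
proof -
  note P = Pairing_props[OF u w]
  have o: "A \<in> Obj C" "B \<in> Obj C"
    using f g Hom_Obj by blast+
  note r = Pr_Hom[OF o]
  have "PrdMap C f g = Pairing C (f \<cdot> Pr1 C A B) (g \<cdot> Pr2 C A B)"
    using f g by (simp add: PrdMap_def Hom_iff)
  then have "PrdMap C f g \<cdot> Pairing C u w =
      Pairing C ((f \<cdot> Pr1 C A B) \<cdot> Pairing C u w) ((g \<cdot> Pr2 C A B) \<cdot> Pairing C u w)"
    using Pairing_comp[OF Comp_Hom[OF r(1) f] Comp_Hom[OF r(2) g] P(1)] by simp
  also have "\<dots> = Pairing C (f \<cdot> u) (g \<cdot> w)"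
    using Comp_assoc[OF P(1) r(1) f] Comp_assoc[OF P(1) r(2) g] P(2,3) by simp
  finally show ?thesis .
qed

lemma PrdMap_comp:
  assumes f: "f \<in> Hom C A A'" and g: "g \<in> Hom C B B'"
    and f': "f' \<in> Hom C A' A''" and g': "g' \<in> Hom C B' B''"
  shows "PrdMap C f' g' \<cdot> PrdMap C f g = PrdMap C (f' \<cdot> f) (g' \<cdot> g)"
proof -
  note r = Pr_Hom[OF Hom_Obj(1)[OF f] Hom_Obj(1)[OF g]]
  show ?thesis
    using PrdMap_Pairing[OF f' g' Comp_Hom[OF r(1) f] Comp_Hom[OF r(2) g]] f g f' g' r
    by (simp add: PrdMap_def arrow_simps)
qed

end

context binary_coproducts
begin

lemma In_Hom:
  assumes "A \<in> Obj C" "B \<in> Obj C"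
  shows "In1 C A B \<in> Hom C A (Cop C A B)" "In2 C A B \<in> Hom C B (Cop C A B)"
  using coproduct[OF assms] by (auto simp: is_coproduct_def)

lemma coproduct_universal:
  assumes "u \<in> Hom C A W" "w \<in> Hom C B W"
  shows "\<exists>!h. h \<in> Hom C (Cop C A B) W \<and> h \<cdot> In1 C A B = u \<and> h \<cdot> In2 C A B = w"
  using coproduct[OF Hom_Obj(1)[OF assms(1)] Hom_Obj(1)[OF assms(2)]] assms
  by (simp add: is_coproduct_def)

lemma Copairing_props:
  assumes "u \<in> Hom C A W" "w \<in> Hom C B W"
  shows "Copairing C u w \<in> Hom C (Cop C A B) W"
    and "Copairing C u w \<cdot> In1 C A B = u"
    and "Copairing C u w \<cdot> In2 C A B = w"
proof -
  have "Copairing C u w =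
      (THE h. h \<in> Hom C (Cop C A B) W \<and> h \<cdot> In1 C A B = u \<and> h \<cdot> In2 C A B = w)"
    using assms by (simp add: Copairing_def Hom_iff)
  with theI'[OF coproduct_universal[OF assms]] show "Copairing C u w \<in> Hom C (Cop C A B) W"
    and "Copairing C u w \<cdot> In1 C A B = u" and "Copairing C u w \<cdot> In2 C A B = w"
    by simp_all
qed

lemma Copairing_unique:
  assumes "A \<in> Obj C" "B \<in> Obj C" "h \<in> Hom C (Cop C A B) W"
    and "h \<cdot> In1 C A B = u" "h \<cdot> In2 C A B = w"
  shows "Copairing C u w = h"
proof -
  have u: "u \<in> Hom C A W" "w \<in> Hom C B W"
    using Comp_Hom[OF In_Hom(1)[OF assms(1,2)] assms(3)] Comp_Hom[OF In_Hom(2)[OF assms(1,2)] assms(3)]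
    by (simp_all only: assms(4,5))
  from ex1_iff_ex_Uniq[THEN iffD1, OF coproduct_universal[OF this], THEN conjunct2] show ?thesis
    by (rule Uniq_D) (intro conjI Copairing_props[OF u] assms(3-5))+
qed

lemma comp_Copairing:
  assumes u: "u \<in> Hom C A W" "w \<in> Hom C B W" and p: "p \<in> Hom C W V"
  shows "p \<cdot> Copairing C u w = Copairing C (p \<cdot> u) (p \<cdot> w)"
proof (rule Copairing_unique[symmetric])
  note P = Copairing_props[OF u]
  show o: "A \<in> Obj C" "B \<in> Obj C"
    using u Hom_Obj by blast+
  show "p \<cdot> Copairing C u w \<in> Hom C (Cop C A B) V"
    by (rule Comp_Hom[OF P(1) p])
  show "(p \<cdot> Copairing C u w) \<cdot> In1 C A B = p \<cdot> u"
    using Comp_assoc[OF In_Hom(1)[OF o] P(1) p] P(2) by simp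
  show "(p \<cdot> Copairing C u w) \<cdot> In2 C A B = p \<cdot> w"
    using Comp_assoc[OF In_Hom(2)[OF o] P(1) p] P(3) by simp
qed

lemma CopMap_Hom:
  assumes "f \<in> Hom C A A'" "g \<in> Hom C B B'"
  shows "CopMap C f g \<in> Hom C (Cop C A B) (Cop C A' B')"
proof -
  note n = In_Hom[OF Hom_Obj(2)[OF assms(1)] Hom_Obj(2)[OF assms(2)]]
  show ?thesis
    using Copairing_props(1)[OF Comp_Hom[OF assms(1) n(1)] Comp_Hom[OF assms(2) n(2)]] assms
    by (simp add: CopMap_def Hom_iff)
qed

lemma codiagonal_natural:
  assumes f: "f \<in> Hom C X Y"
  shows "Copairing C (Ide C Y) (Ide C Y) \<cdot> CopMap C f f =
    f \<cdot> Copairing C (Ide C X) (Ide C X)"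
proof -
  have o: "X \<in> Obj C" "Y \<in> Obj C"
    using f Hom_Obj by blast+
  note i = Ide_Hom[OF o(2)]
  note P = Copairing_props[OF i i]
  note n = In_Hom[OF o(2) o(2)]
  have "Copairing C (Ide C Y) (Ide C Y) \<cdot> CopMap C f f =
      Copairing C (Copairing C (Ide C Y) (Ide C Y) \<cdot> In1 C Y Y \<cdot> f)
        (Copairing C (Ide C Y) (Ide C Y) \<cdot> In2 C Y Y \<cdot> f)"
    using comp_Copairing[OF Comp_Hom[OF f n(1)] Comp_Hom[OF f n(2)] P(1)] f
    by (simp add: CopMap_def Hom_iff)
  also have "\<dots> = Copairing C f f"
    using Comp_assoc[OF f n(1) P(1)] Comp_assoc[OF f n(2) P(1)] P(2,3) Ide_Comp[OF f] by simp
  also have "\<dots> = f \<cdot> Copairing C (Ide C X) (Ide C X)"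
    using comp_Copairing[OF Ide_Hom[OF o(1)] Ide_Hom[OF o(1)] f] Comp_Ide[OF f] by simp
  finally show ?thesis .
qed

end

section \<open>Imaginary morphisms\<close>

text \<open>The rules below are the laws by which real morphisms, acting on the left by composition and
  on the right through \<open>P\<close>, move in and out of Kleisli composites.\<close>

context comonad
begin

lemma PArr_arrow:
  assumes "f \<in> Arr C"
  shows "PArr C f \<in> Arr C" "Dom C (PArr C f) = PObj C (Dom C f)"
    "Cod C (PArr C f) = PObj C (Cod C f)"
  using assms PArr_Hom[of f "Dom C f" "Cod C f"] by (auto simp: Hom_iff)

lemma Delta_arrow:
  assumes "A \<in> Obj C"
  shows "Delta C A \<in> Arr C" "Dom C (Delta C A) = PObj C A"
    "Cod C (Delta C A) = PObj C (PObj C A)"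
  using assms Delta_Hom by (auto simp: Hom_iff)

lemma Eps_arrow:
  assumes "A \<in> Obj C"
  shows "Eps C A \<in> Arr C" "Dom C (Eps C A) = PObj C A" "Cod C (Eps C A) = A"
  using assms Eps_Hom by (auto simp: Hom_iff)

lemma PArr_comp_arrow:
  assumes "f \<in> Arr C" "g \<in> Arr C" "Cod C f = Dom C g"
  shows "PArr C (g \<cdot> f) = PArr C g \<cdot> PArr C f"
  using assms PArr_Comp[of f "Dom C f" "Cod C f" g "Cod C g"] by (auto simp: Hom_iff)

lemmas im_arrow_simps = arrow_simps PArr_arrow Delta_arrow Eps_arrow PArr_comp_arrow

lemma ImComp_Hom:
  assumes "a \<in> Hom C (PObj C A) B" "b \<in> Hom C (PObj C B) D" "A \<in> Obj C"
  shows "ImComp C A b a \<in> Hom C (PObj C A) D"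
  using assms by (simp add: ImComp_def im_arrow_simps)

lemma ImComp_Real:
  assumes a: "a \<in> Hom C (PObj C B) D" and u: "u \<in> Hom C A B"
  shows "ImComp C A a (Real C u) = a \<cdot> PArr C u"
proof -
  have o: "A \<in> Obj C"
    using u Hom_Obj by blast
  show ?thesis
    using a u o PArr_Eps_Delta[OF o] PArr_arrow[of u] by (simp add: ImComp_def Real_def im_arrow_simps)
qed

lemma ImComp_real_left:
  assumes "a \<in> Hom C (PObj C A) B" "b \<in> Hom C (PObj C B) D" "u \<in> Hom C D E" "A \<in> Obj C"
  shows "ImComp C A (u \<cdot> b) a = u \<cdot> ImComp C A b a"
  using assms by (simp add: ImComp_def im_arrow_simps)

lemma ImComp_real_middle:
  assumes "a \<in> Hom C (PObj C A) B" "u \<in> Hom C B D" "b \<in> Hom C (PObj C D) E" "A \<in> Obj C"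
  shows "ImComp C A (b \<cdot> PArr C u) a = ImComp C A b (u \<cdot> a)"
  using assms by (simp add: ImComp_def im_arrow_simps)

lemma ImComp_real_right:
  assumes u: "u \<in> Hom C A A'" and a: "a \<in> Hom C (PObj C A') B" and b: "b \<in> Hom C (PObj C B) D"
  shows "ImComp C A b (a \<cdot> PArr C u) = ImComp C A' b a \<cdot> PArr C u"
proof -
  have "A \<in> Obj C" "A' \<in> Obj C"
    using u Hom_Obj by blast+
  then show ?thesis
    using u a b Delta_natural[OF u] by (simp add: ImComp_def im_arrow_simps)
qed

lemma Real_comp_PArr:
  assumes "u \<in> Hom C A B" "w \<in> Hom C B D"
  shows "Real C w \<cdot> PArr C u = Real C (w \<cdot> u)"
  using assms Eps_natural[OF assms(1)] Hom_Obj[OF assms(1)]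
  by (simp add: Real_def im_arrow_simps)

lemma comp_Real:
  assumes "u \<in> Hom C A B" "w \<in> Hom C B D"
  shows "w \<cdot> Real C u = Real C (w \<cdot> u)"
  using assms Hom_Obj[OF assms(1)] by (simp add: Real_def im_arrow_simps)

lemma Real_Hom:
  assumes "u \<in> Hom C A B"
  shows "Real C u \<in> Hom C (PObj C A) B"
  using assms Hom_Obj[OF assms(1)] by (simp add: Real_def im_arrow_simps)

end

section \<open>Imaginary addition and retracts of Schreier split extensions\<close>

locale imaginary_splitting =
  binary_products C + binary_coproducts C + comonad C
  for C :: "('o, 'a, 'm) imaginary_data_scheme" (structure) +
  assumes splitting: "natural_imaginary_splitting C"
begin

lemma Split_Hom:
  assumes "A \<in> Obj C" "B \<in> Obj C"
  shows "Split C A B \<in> Hom C (PObj C (Prd C A B)) (Cop C A B)"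
  using splitting assms by (auto simp: natural_imaginary_splitting_def)

lemma ImAdd_Hom:
  assumes "X \<in> Obj C"
  shows "ImAdd C X \<in> Hom C (PObj C (Prd C X X)) X"
  unfolding ImAdd_def
  by (rule Comp_Hom[OF Split_Hom[OF assms assms]
        Copairing_props(1)[OF Ide_Hom[OF assms] Ide_Hom[OF assms]]])

text \<open>The imaginary splitting exchanges \<open>f \<times> f\<close> for \<open>f + f\<close>, which the codiagonal turns into \<open>f\<close>.\<close>

lemma ImAdd_natural:
  assumes f: "f \<in> Hom C X Y"
  shows "ImAdd C Y \<cdot> PArr C (PrdMap C f f) = f \<cdot> ImAdd C X"
proof -
  have o: "X \<in> Obj C" "Y \<in> Obj C"
    using f Hom_Obj by blast+
  have t: "Split C Y Y \<cdot> PArr C (PrdMap C f f) = CopMap C f f \<cdot> Split C X X"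
    using splitting f by (auto simp: natural_imaginary_splitting_def Hom_iff)
  note c = Copairing_props(1)[OF Ide_Hom Ide_Hom]
  note s = Split_Hom[OF o(1) o(1)] Split_Hom[OF o(2) o(2)]
  have "ImAdd C Y \<cdot> PArr C (PrdMap C f f) =
      Copairing C (Ide C Y) (Ide C Y) \<cdot> Split C Y Y \<cdot> PArr C (PrdMap C f f)"
    unfolding ImAdd_def
    by (rule Comp_assoc[OF PArr_Hom[OF PrdMap_props(1)[OF f f]] s(2) c[OF o(2) o(2)]])
  also have "\<dots> = (Copairing C (Ide C Y) (Ide C Y) \<cdot> CopMap C f f) \<cdot> Split C X X"
    unfolding t by (rule Comp_assoc[OF s(1) CopMap_Hom[OF f f] c[OF o(2) o(2)], symmetric])
  also have "\<dots> = f \<cdot> ImAdd C X"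
    unfolding codiagonal_natural[OF f] ImAdd_def by (rule Comp_assoc[OF s(1) c[OF o(1) o(1)] f])
  finally show ?thesis .
qed

text \<open>A Schreier structure \<open>q\<close> on \<open>(h, u)\<close> is transported to its retract \<open>(g, v)\<close> as
  \<open>r\<^sub>K q P(s)\<close>. The maps \<open>s\<^sub>K\<close>, \<open>s\<close>, \<open>s\<^sub>Z\<close> on kernels, total objects and bases embed the latter
  split extension into the former, and \<open>r\<^sub>K\<close>, \<open>r\<close>, \<open>r\<^sub>Z\<close> are the corresponding retractions.\<close>

lemma intrinsic_schreier_retract:
  assumes schreier: "intrinsic_schreier C X W h u K k"
    and split: "split_epi C Y Z g v"
    and kernel: "is_kernel C g L l"
    and r: "r \<in> Hom C X Y" and s: "s \<in> Hom C Y X" and rs: "r \<cdot> s = Ide C Y"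
    and rZ: "r\<^sub>Z \<in> Hom C W Z" and sZ: "s\<^sub>Z \<in> Hom C Z W" and rsZ: "r\<^sub>Z \<cdot> s\<^sub>Z = Ide C Z"
    and rK: "r\<^sub>K \<in> Hom C K L" and sK: "s\<^sub>K \<in> Hom C L K" and rsK: "r\<^sub>K \<cdot> s\<^sub>K = Ide C L"
    and l_rK: "l \<cdot> r\<^sub>K = r \<cdot> k" and k_sK: "k \<cdot> s\<^sub>K = s \<cdot> l"
    and r_u: "r \<cdot> u = v \<cdot> r\<^sub>Z" and s_v: "s \<cdot> v = u \<cdot> s\<^sub>Z"
    and h_s: "h \<cdot> s = s\<^sub>Z \<cdot> g"
  shows "intrinsic_schreier C Y Z g v L l"
proof -
  from schreier obtain q where q: "q \<in> Hom C (PObj C X) K"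
    and decomposition:
      "ImComp C X (ImAdd C X) (Pairing C (k \<cdot> q) (Real C (u \<cdot> h))) = Real C (Ide C X)"
    and retraction:
      "ImComp C (Prd C K W) (ImComp C (Prd C X X) q (ImAdd C X)) (Real C (PrdMap C k u)) =
        Real C (Pr1 C K W)"
    and h: "h \<in> Hom C X W" and u: "u \<in> Hom C W X" and k: "k \<in> Hom C K X"
    by (auto simp: intrinsic_schreier_def split_epi_def is_kernel_def Hom_def)
  from split kernel have g: "g \<in> Hom C Y Z" and v: "v \<in> Hom C Z Y" and l: "l \<in> Hom C L Y"
    by (auto simp: split_epi_def is_kernel_def Hom_def)
  have X: "X \<in> Obj C" and Y: "Y \<in> Obj C" and Z: "Z \<in> Obj C" and W: "W \<in> Obj C"
    and K: "K \<in> Obj C" and L: "L \<in> Obj C"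
    using g h k l Hom_Obj by blast+
  have YY: "Prd C Y Y \<in> Obj C"
    using Pr_Hom(1)[OF Y Y] Hom_Obj by blast
  note Ps = PArr_Hom[OF s]
  note qPs = Comp_Hom[OF Ps q]
  note addX = ImAdd_Hom[OF X] and addY = ImAdd_Hom[OF Y]
  note uh = Comp_Hom[OF h u]
  note kq = Comp_Hom[OF q k]
  define q' where "q' = r\<^sub>K \<cdot> q \<cdot> PArr C s"
  have q': "q' \<in> Hom C (PObj C Y) L"
    unfolding q'_def by (rule Comp_Hom[OF qPs rK])
  define p where "p = Pairing C (k \<cdot> q) (Real C (u \<cdot> h))"
  have p: "p \<in> Hom C (PObj C X) (Prd C X X)"
    unfolding p_def by (rule Pairing_props(1)[OF kq Real_Hom[OF uh]])
  have pPs: "p \<cdot> PArr C s \<in> Hom C (PObj C Y) (Prd C X X)"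
    by (rule Comp_Hom[OF Ps p])
  note rr = PrdMap_props(1)[OF r r] and ss = PrdMap_props(1)[OF s s]

  have lq': "l \<cdot> q' = r \<cdot> (k \<cdot> q) \<cdot> PArr C s"
  proof -
    have "l \<cdot> q' = (l \<cdot> r\<^sub>K) \<cdot> q \<cdot> PArr C s"
      unfolding q'_def by (rule Comp_assoc[OF qPs rK l, symmetric])
    also have "\<dots> = r \<cdot> (k \<cdot> q) \<cdot> PArr C s"
      unfolding l_rK using r k q Ps by (simp add: arrow_simps)
    finally show ?thesis .
  qed
  have vg: "Real C (v \<cdot> g) = r \<cdot> Real C (u \<cdot> h) \<cdot> PArr C s"
  proof -
    have "r \<cdot> (u \<cdot> h) \<cdot> s = (r \<cdot> u) \<cdot> h \<cdot> s"
      using r u h s by (simp add: arrow_simps)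
    also have "\<dots> = v \<cdot> (r\<^sub>Z \<cdot> s\<^sub>Z) \<cdot> g"
      unfolding r_u h_s using v rZ sZ g by (simp add: arrow_simps)
    also have "\<dots> = v \<cdot> g"
      unfolding rsZ using g by (simp add: Ide_Comp)
    finally show ?thesis
      using Real_comp_PArr[OF s uh] comp_Real[OF Comp_Hom[OF s uh] r] by simp
  qed
  \<comment> \<open>The two summands in \<open>Y\<close> are the images under \<open>r\<close> of those in \<open>X\<close>, restricted along \<open>s\<close>.\<close>
  have pair: "Pairing C (l \<cdot> q') (Real C (v \<cdot> g)) = PrdMap C r r \<cdot> p \<cdot> PArr C s"
    unfolding lq' vg p_def Pairing_comp[OF kq Real_Hom[OF uh] Ps]
    by (rule PrdMap_Pairing[OF r r Comp_Hom[OF Ps kq] Comp_Hom[OF Ps Real_Hom[OF uh]], symmetric])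
  have "ImComp C Y (ImAdd C Y) (Pairing C (l \<cdot> q') (Real C (v \<cdot> g))) =
      ImComp C Y (r \<cdot> ImAdd C X) (p \<cdot> PArr C s)"
    unfolding pair ImComp_real_middle[OF pPs rr addY Y, symmetric] ImAdd_natural[OF r] ..
  also have "\<dots> = r \<cdot> ImComp C X (ImAdd C X) p \<cdot> PArr C s"
    unfolding ImComp_real_left[OF pPs addX r Y] ImComp_real_right[OF s p addX] ..
  also have "\<dots> = Real C (Ide C Y)"
    unfolding p_def decomposition
    using Real_comp_PArr[OF s Ide_Hom[OF X]] Ide_Comp[OF s] comp_Real[OF s r] rs by simp
  finally have 1: "ImComp C Y (ImAdd C Y) (Pairing C (l \<cdot> q') (Real C (v \<cdot> g))) =
    Real C (Ide C Y)" .

  note qaddX = ImComp_Hom[OF addX q]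
  have XX: "Prd C X X \<in> Obj C" and KW: "Prd C K W \<in> Obj C"
    using Pr_Hom(1)[OF X X] Pr_Hom(1)[OF K W] Hom_Obj by blast+
  define m where "m = ImComp C (Prd C X X) q (ImAdd C X)"
  have m: "m \<in> Hom C (PObj C (Prd C X X)) K"
    unfolding m_def by (rule qaddX[OF XX])
  have m_ku: "m \<cdot> PArr C (PrdMap C k u) = Real C (Pr1 C K W)"
    using retraction ImComp_Real[OF m PrdMap_props(1)[OF k u]] unfolding m_def by simp
  note ku = PrdMap_props(1)[OF k u] and lv = PrdMap_props(1)[OF l v]
    and sKZ = PrdMap_props(1)[OF sK sZ]
  \<comment> \<open>Under \<open>s\<close>, a pair from \<open>L\<close> and \<open>Z\<close> becomes one from \<open>K\<close> and \<open>W\<close>, to which the equation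
    for \<open>q\<close> applies.\<close>
  have args: "PrdMap C s s \<cdot> PrdMap C l v = PrdMap C k u \<cdot> PrdMap C s\<^sub>K s\<^sub>Z"
    unfolding PrdMap_comp[OF l v s s] PrdMap_comp[OF sK sZ k u] k_sK s_v ..
  have q'add: "ImComp C (Prd C Y Y) q' (ImAdd C Y) = r\<^sub>K \<cdot> m \<cdot> PArr C (PrdMap C s s)"
    unfolding q'_def ImComp_real_left[OF addY qPs rK YY] ImComp_real_middle[OF addY s q YY]
      ImAdd_natural[OF s, symmetric] ImComp_real_right[OF ss addX q] m_def ..
  have "ImComp C (Prd C L Z) (ImComp C (Prd C Y Y) q' (ImAdd C Y)) (Real C (PrdMap C l v)) =
      (r\<^sub>K \<cdot> m \<cdot> PArr C (PrdMap C s s)) \<cdot> PArr C (PrdMap C l v)"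
    unfolding q'add[symmetric] by (rule ImComp_Real[OF ImComp_Hom[OF addY q' YY] lv])
  also have "\<dots> = r\<^sub>K \<cdot> m \<cdot> PArr C (PrdMap C s s \<cdot> PrdMap C l v)"
    using rK m ss lv by (simp add: im_arrow_simps)
  also have "\<dots> = r\<^sub>K \<cdot> (m \<cdot> PArr C (PrdMap C k u)) \<cdot> PArr C (PrdMap C s\<^sub>K s\<^sub>Z)"
    unfolding args using rK m ku sKZ by (simp add: im_arrow_simps)
  also have "\<dots> = Real C (r\<^sub>K \<cdot> s\<^sub>K \<cdot> Pr1 C L Z)"
    unfolding m_ku Real_comp_PArr[OF sKZ Pr_Hom(1)[OF K W]] PrdMap_props(2)[OF sK sZ]
    by (rule comp_Real[OF Comp_Hom[OF Pr_Hom(1)[OF L Z] sK] rK])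
  also have "\<dots> = Real C (Pr1 C L Z)"
    using Comp_assoc[OF Pr_Hom(1)[OF L Z] sK rK] rsK Ide_Comp[OF Pr_Hom(1)[OF L Z]] by simp
  finally have 2: "ImComp C (Prd C L Z) (ImComp C (Prd C Y Y) q' (ImAdd C Y))
    (Real C (PrdMap C l v)) = Real C (Pr1 C L Z)" .
  from split kernel q' 1 2 show ?thesis
    unfolding intrinsic_schreier_def by blast
qed

end

section \<open>Composites of split epimorphisms\<close>

theorem proposition7p2:
  fixes C :: "('o, 'a, 'm) imaginary_data_scheme"
  assumes "regular_category C"
    and "unital_category C"
    and "binary_products C"
    and "binary_coproducts C"
    and "comonadic_covers C"
    and "natural_imaginary_splitting C"
    and "split_epi C X Y f s"
    and "split_epi C Y Z g v"
    and "is_kernel C g L l"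
    and "intrinsic_schreier C X Z (g \<cdot>\<^bsub>C\<^esub> f) (s \<cdot>\<^bsub>C\<^esub> v) K k"
  shows "intrinsic_schreier C Y Z g v L l"
proof -
  interpret binary_products C by fact
  interpret binary_coproducts C by fact
  interpret comonadic_covers C by fact
  interpret imaginary_splitting C by unfold_locales fact
  have f: "f \<in> Hom C X Y" and s: "s \<in> Hom C Y X" and fs: "f \<cdot>\<^bsub>C\<^esub> s = Ide C Y"
    and g: "g \<in> Hom C Y Z" and v: "v \<in> Hom C Z Y"
    using assms(7,8) by (auto simp: split_epi_def)
  have Y: "Y \<in> Obj C" and Z: "Z \<in> Obj C"
    using g Hom_Obj by blast+
  note gf = Comp_Hom[OF f g]
  have k: "k \<in> Hom C K X" and gfk: "(g \<cdot>\<^bsub>C\<^esub> f) \<cdot>\<^bsub>C\<^esub> k = Zero C K Z"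
    and k_univ: "\<And>W u. u \<in> Hom C W X \<Longrightarrow> (g \<cdot>\<^bsub>C\<^esub> f) \<cdot>\<^bsub>C\<^esub> u = Zero C W Z \<Longrightarrow>
      \<exists>!h. h \<in> Hom C W K \<and> k \<cdot>\<^bsub>C\<^esub> h = u"
    using assms(10) gf by (auto simp: intrinsic_schreier_def is_kernel_def Hom_iff)
  have l: "l \<in> Hom C L Y" and gl: "g \<cdot>\<^bsub>C\<^esub> l = Zero C L Z"
    and l_univ: "\<And>W u. u \<in> Hom C W Y \<Longrightarrow> g \<cdot>\<^bsub>C\<^esub> u = Zero C W Z \<Longrightarrow>
      \<exists>!h. h \<in> Hom C W L \<and> l \<cdot>\<^bsub>C\<^esub> h = u"
    using assms(9) g by (auto simp: is_kernel_def Hom_iff)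
  have L: "L \<in> Obj C"
    using l Hom_Obj by blast
  \<comment> \<open>The retraction \<open>(f, s)\<close> lies over the identity of \<open>Z\<close>, so it restricts to the kernels.\<close>
  have gfs: "(g \<cdot>\<^bsub>C\<^esub> f) \<cdot>\<^bsub>C\<^esub> s = g"
    using Comp_assoc[OF s f g] fs Comp_Ide[OF g] by simp
  have "g \<cdot>\<^bsub>C\<^esub> f \<cdot>\<^bsub>C\<^esub> k = Zero C K Z"
    using gfk Comp_assoc[OF k f g] by simp
  then obtain f' where f': "f' \<in> Hom C K L" and lf': "l \<cdot>\<^bsub>C\<^esub> f' = f \<cdot>\<^bsub>C\<^esub> k"
    using l_univ[OF Comp_Hom[OF k f]] by blast
  have "(g \<cdot>\<^bsub>C\<^esub> f) \<cdot>\<^bsub>C\<^esub> s \<cdot>\<^bsub>C\<^esub> l = Zero C L Z"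
    using Comp_assoc[OF l s gf] gfs gl by simp
  then obtain s' where s': "s' \<in> Hom C L K" and ks': "k \<cdot>\<^bsub>C\<^esub> s' = s \<cdot>\<^bsub>C\<^esub> l"
    using k_univ[OF Comp_Hom[OF l s]] by blast
  have "l \<cdot>\<^bsub>C\<^esub> f' \<cdot>\<^bsub>C\<^esub> s' = (f \<cdot>\<^bsub>C\<^esub> k) \<cdot>\<^bsub>C\<^esub> s'"
    using Comp_assoc[OF s' f' l] lf' by simp
  also have "\<dots> = (f \<cdot>\<^bsub>C\<^esub> s) \<cdot>\<^bsub>C\<^esub> l"
    using Comp_assoc[OF s' k f] Comp_assoc[OF l s f] ks' by simp
  also have "\<dots> = l"
    using fs Ide_Comp[OF l] by simp
  finally have "l \<cdot>\<^bsub>C\<^esub> f' \<cdot>\<^bsub>C\<^esub> s' = l" .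
  then have fs': "f' \<cdot>\<^bsub>C\<^esub> s' = Ide C L"
    using ex1_iff_ex_Uniq[THEN iffD1, OF l_univ[OF l gl], THEN conjunct2, THEN Uniq_D]
      Comp_Hom[OF s' f'] Ide_Hom[OF L] Comp_Ide[OF l] by simp
  show ?thesis
  proof (rule intrinsic_schreier_retract[OF assms(10,8,9) f s fs Ide_Hom[OF Z] Ide_Hom[OF Z] _
        f' s' fs' lf' ks'])
    show "Ide C Z \<cdot>\<^bsub>C\<^esub> Ide C Z = Ide C Z"
      by (rule Ide_Comp[OF Ide_Hom[OF Z]])
    show "f \<cdot>\<^bsub>C\<^esub> s \<cdot>\<^bsub>C\<^esub> v = v \<cdot>\<^bsub>C\<^esub> Ide C Z"
      using Comp_assoc[OF v s f] fs Ide_Comp[OF v] Comp_Ide[OF v] by simp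
    show "s \<cdot>\<^bsub>C\<^esub> v = (s \<cdot>\<^bsub>C\<^esub> v) \<cdot>\<^bsub>C\<^esub> Ide C Z"
      using Comp_Ide[OF Comp_Hom[OF v s]] by simp
    show "(g \<cdot>\<^bsub>C\<^esub> f) \<cdot>\<^bsub>C\<^esub> s = Ide C Z \<cdot>\<^bsub>C\<^esub> g"
      using gfs Ide_Comp[OF g] by simp
  qed
qed

end
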